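(* Let $E_{8,2}$ be the weighted tree with vertices $E_1,\dots,E_8$, where $E_1$ has weight $3$, all other vertices have weight $2$, and the edges are those of the chain $E_1 - E_2 - E_3 - E_4 - E_5 - E_6 - E_7$ together with one edge joining $E_8$ and $E_3$. Then the number of elements of the triple root system $R(E_{8,2})$ is $212$.
   Context: For a finite weighted tree $\Gamma$ with vertices $V_i$ of weights $w_i$, the intersection form on $\bigoplus_i\mathbb{Z}V_i$ is the symmetric bilinear form with $(V_i\cdot V_i)=-w_i$ and, for $i\neq j$, $(V_i\cdot V_j)=1$ if $V_i$ and $V_j$ are joined by an edge and $0$ otherwise. A non-zero element $\sum m_iV_i$ is a positive (resp. negative) divisor if all $m_i\ge 0$ (resp. all $m_i\le 0$). The triple root system $R(\Gamma)$ is the set of all positive and negative divisors $Y$ with $(Y\cdot Y)=-2$ or $(Y\cdot Y)=-3$. *)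

theory Defs
  imports Main "HOL-Library.Poly_Mapping"
begin

record 'a weighted_graph =
  verts :: "'a set"
  edges :: "'a set set"
  weight :: "'a \<Rightarrow> int"

definition is_cycle :: "'a weighted_graph \<Rightarrow> 'a list \<Rightarrow> bool" where
  "is_cycle \<Gamma> xs \<longleftrightarrow> distinct xs \<and> length xs \<ge> 3 \<and>
     (\<forall>i < length xs. {xs ! i, xs ! (Suc i mod length xs)} \<in> edges \<Gamma>)"

definition weighted_tree :: "'a weighted_graph \<Rightarrow> bool" where
  "weighted_tree \<Gamma> \<longleftrightarrow>
     finite (verts \<Gamma>) \<and> verts \<Gamma> \<noteq> {} \<and>
     (\<forall>e \<in> edges \<Gamma>. e \<subseteq> verts \<Gamma> \<and> card e = 2) \<and>
     (\<forall>u \<in> verts \<Gamma>. \<forall>v \<in> verts \<Gamma>. (u, v) \<in> {(x, y). {x, y} \<in> edges \<Gamma>}\<^sup>*) \<and>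
     (\<nexists>xs. is_cycle \<Gamma> xs)"

text \<open>The free abelian group on the vertices: an element \<open>\<Sum> m\<^sub>v v\<close> is the finitely supported
  function \<open>v \<mapsto> m\<^sub>v\<close>, supported on the vertex set.\<close>

definition divisors :: "'a weighted_graph \<Rightarrow> ('a \<Rightarrow>\<^sub>0 int) set" where
  "divisors \<Gamma> = {Y. Poly_Mapping.keys Y \<subseteq> verts \<Gamma>}"

definition vertex_intersection :: "'a weighted_graph \<Rightarrow> 'a \<Rightarrow> 'a \<Rightarrow> int" where
  "vertex_intersection \<Gamma> u v =
     (if u = v then - weight \<Gamma> u else if {u, v} \<in> edges \<Gamma> then 1 else 0)"

definition intersection :: "'a weighted_graph \<Rightarrow> ('a \<Rightarrow>\<^sub>0 int) \<Rightarrow> ('a \<Rightarrow>\<^sub>0 int) \<Rightarrow> int" where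
  "intersection \<Gamma> Y Z =
     (\<Sum>u \<in> verts \<Gamma>. \<Sum>v \<in> verts \<Gamma>.
        Poly_Mapping.lookup Y u * Poly_Mapping.lookup Z v * vertex_intersection \<Gamma> u v)"

definition positive_divisors :: "'a weighted_graph \<Rightarrow> ('a \<Rightarrow>\<^sub>0 int) set" where
  "positive_divisors \<Gamma> =
     {Y \<in> divisors \<Gamma>. Y \<noteq> 0 \<and> (\<forall>v \<in> verts \<Gamma>. Poly_Mapping.lookup Y v \<ge> 0)}"

definition negative_divisors :: "'a weighted_graph \<Rightarrow> ('a \<Rightarrow>\<^sub>0 int) set" where
  "negative_divisors \<Gamma> =
     {Y \<in> divisors \<Gamma>. Y \<noteq> 0 \<and> (\<forall>v \<in> verts \<Gamma>. Poly_Mapping.lookup Y v \<le> 0)}"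

definition triple_root_system :: "'a weighted_graph \<Rightarrow> ('a \<Rightarrow>\<^sub>0 int) set" where
  "triple_root_system \<Gamma> =
     {Y \<in> positive_divisors \<Gamma> \<union> negative_divisors \<Gamma>.
        intersection \<Gamma> Y Y = - 2 \<or> intersection \<Gamma> Y Y = - 3}"

text \<open>The vertex \<open>E\<^sub>i\<close> is represented by the number \<open>i\<close>.\<close>

definition E82 :: "nat weighted_graph" where
  "E82 = \<lparr>verts = {1..8},
          edges = {{1, 2}, {2, 3}, {3, 4}, {4, 5}, {5, 6}, {6, 7}, {3, 8}},
          weight = (\<lambda>i. if i = 1 then 3 else 2)\<rparr>"

text \<open>For acyclicity, note that every vertex of \<open>E82\<close> has at most one smaller neighbour, whereas
  the largest vertex of a cycle would have two.\<close>

lemma E82_smaller_neighbour_unique: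
  assumes "{x, m} \<in> edges E82" "{y, m} \<in> edges E82" "x < m" "y < m"
  shows "x = y"
  using assms by (auto simp: E82_def doubleton_eq_iff)

lemma E82_no_cycle: "\<not> is_cycle E82 xs"
proof
  assume "is_cycle E82 xs"
  then have d: "distinct xs" and n: "length xs \<ge> 3"
    and e: "\<And>i. i < length xs \<Longrightarrow> {xs ! i, xs ! (Suc i mod length xs)} \<in> edges E82"
    by (auto simp: is_cycle_def)
  define n where "n = length xs"
  have "Max (set xs) \<in> set xs" using n by (intro Max_in) auto
  then obtain k where k: "k < n" "xs ! k = Max (set xs)"
    by (auto simp: in_set_conv_nth n_def)
  define a where "a = (if k = 0 then n - 1 else k - 1)"
  define b where "b = Suc k mod n"
  have a: "a < n" "Suc a mod n = k" "a \<noteq> k"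
    using k(1) n by (auto simp: a_def n_def)
  have b: "b < n" "b \<noteq> k" "a \<noteq> b"
    using k(1) n unfolding a_def b_def n_def[symmetric]
    by (cases "Suc k = n"; auto)+
  have less: "xs ! i < xs ! k" if "i < n" "i \<noteq> k" for i
    using that k d by (metis List.finite_set Max_ge n_def nat_less_le nth_eq_iff_index_eq nth_mem)
  have "{xs ! a, xs ! k} \<in> edges E82" using e[of a] a by (simp add: n_def)
  moreover have "{xs ! b, xs ! k} \<in> edges E82"
    using e[of k] k by (simp add: n_def b_def insert_commute)
  ultimately have "xs ! a = xs ! b"
    using less a b by (blast intro: E82_smaller_neighbour_unique)
  then show False using a b d by (simp add: n_def nth_eq_iff_index_eq)
qed

lemma weighted_tree_E82: "weighted_tree E82"
proof -
  let ?R = "{(x, y). {x, y} \<in> edges E82}"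
  have vs: "verts E82 = {1, 2, 3, 4, 5, 6, 7, 8}"
    by (auto simp: E82_def)
  have sym: "sym ?R" by (auto simp: sym_def insert_commute)
  have st: "(1, 2) \<in> ?R" "(2, 3) \<in> ?R" "(3, 4) \<in> ?R" "(4, 5) \<in> ?R" "(5, 6) \<in> ?R"
    "(6, 7) \<in> ?R" "(3, 8) \<in> ?R"
    by (auto simp: E82_def)
  have one: "(1, v) \<in> ?R\<^sup>*" if "v \<in> verts E82" for v
  proof -
    have 2: "(1, 2) \<in> ?R\<^sup>*" using st(1) by (rule r_into_rtrancl)
    have 3: "(1, 3) \<in> ?R\<^sup>*" using 2 st(2) by (rule rtrancl_into_rtrancl)
    have 4: "(1, 4) \<in> ?R\<^sup>*" using 3 st(3) by (rule rtrancl_into_rtrancl)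
    have 5: "(1, 5) \<in> ?R\<^sup>*" using 4 st(4) by (rule rtrancl_into_rtrancl)
    have 6: "(1, 6) \<in> ?R\<^sup>*" using 5 st(5) by (rule rtrancl_into_rtrancl)
    have 7: "(1, 7) \<in> ?R\<^sup>*" using 6 st(6) by (rule rtrancl_into_rtrancl)
    have 8: "(1, 8) \<in> ?R\<^sup>*" using 3 st(7) by (rule rtrancl_into_rtrancl)
    show ?thesis
      using that 2 3 4 5 6 7 8 unfolding vs by (elim insertE emptyE) simp_all
  qed
  have "(u, v) \<in> ?R\<^sup>*" if "u \<in> verts E82" "v \<in> verts E82" for u v
    using one[OF that(1)] one[OF that(2)] sym_rtrancl[OF sym]
    by (meson rtrancl_trans symD)
  moreover have "\<forall>e \<in> edges E82. e \<subseteq> verts E82 \<and> card e = 2"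
    by (auto simp: E82_def)
  ultimately show ?thesis
    using E82_no_cycle by (auto simp: weighted_tree_def vs)
qed

end

theory Submission
  imports Defs
begin

text \<open>
  Eliminating the leaves towards the branch vertex \<open>E\<^sub>3\<close> completes the square and writes
  \<open>-60 (Y \<cdot> Y)\<close> as a sum of eight weighted integer squares (\<open>E82_form_sum_of_squares\<close>).
  A divisor with \<open>-(Y \<cdot> Y) \<le> 3\<close> makes every partial sum at most \<open>180\<close>, so the coefficients can be
  chosen one after the other, each from at most six values, and a pruned search finds the
  \<open>106\<close> positive ones. Negation gives as many negative ones.
\<close>

text \<open>This is \<open>-(Y \<cdot> Y)\<close> in coordinates; with this sign the form is
  positive definite.\<close>

definition E82_form :: "int \<Rightarrow> int \<Rightarrow> int \<Rightarrow> int \<Rightarrow> int \<Rightarrow> int \<Rightarrow> int \<Rightarrow> int \<Rightarrow> int" where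
  "E82_form x1 x2 x3 x4 x5 x6 x7 x8 =
     3 * x1^2 + 2 * (x2^2 + x3^2 + x4^2 + x5^2 + x6^2 + x7^2 + x8^2)
     - 2 * (x1*x2 + x2*x3 + x3*x4 + x4*x5 + x5*x6 + x6*x7 + x3*x8)"

text \<open>Each square but the first couples one coefficient with that of its neighbour on the side
  of \<open>x3\<close>. After elimination of the three branches, \<open>x3^2\<close> keeps the
  coefficient 2 - 3/5 - 1/2 - 4/5 = 1/10, and 60 is the least common denominator of all eight
  squares.\<close>

lemma E82_form_sum_of_squares:
  "60 * E82_form x1 x2 x3 x4 x5 x6 x7 x8 =
     6 * x3^2 + 4 * (5*x2 - 3*x3)^2 + 20 * (3*x1 - x2)^2 + 30 * (2*x8 - x3)^2
     + 3 * (5*x4 - 4*x3)^2 + 5 * (4*x5 - 3*x4)^2 + 10 * (3*x6 - 2*x5)^2 + 30 * (2*x7 - x6)^2"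
  unfolding E82_form_def by (simp add: power2_eq_square algebra_simps)

text \<open>The coefficients are chosen outwards from \<open>x3\<close>, so that each new square
  contains only one new unknown. Generators over singleton lists serve as let-bindings for the
  running sums. The final values are 60 * 2 and 60 * 3.\<close>

definition E82_search :: "int list list" where
  "E82_search =
     [[x1, x2, x3, x4, x5, x6, x7, x8].
        x3 \<leftarrow> [0..5],
        x2 \<leftarrow> [0..5], s2 \<leftarrow> [6 * x3^2 + 4 * (5*x2 - 3*x3)^2], s2 \<le> 180,
        x1 \<leftarrow> [0..5], s1 \<leftarrow> [s2 + 20 * (3*x1 - x2)^2], s1 \<le> 180,
        x8 \<leftarrow> [0..5], s8 \<leftarrow> [s1 + 30 * (2*x8 - x3)^2], s8 \<le> 180,
        x4 \<leftarrow> [0..5], s4 \<leftarrow> [s8 + 3 * (5*x4 - 4*x3)^2], s4 \<le> 180,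
        x5 \<leftarrow> [0..5], s5 \<leftarrow> [s4 + 5 * (4*x5 - 3*x4)^2], s5 \<le> 180,
        x6 \<leftarrow> [0..5], s6 \<leftarrow> [s5 + 10 * (3*x6 - 2*x5)^2], s6 \<le> 180,
        x7 \<leftarrow> [0..5], s7 \<leftarrow> [s6 + 30 * (2*x7 - x6)^2], s7 = 120 \<or> s7 = 180]"

lemma card_E82_search: "card (set E82_search) = 106"
proof -
  have "length E82_search = 106 \<and> distinct E82_search"
    \<comment> \<open>Pruning after each coefficient from \<open>x2\<close> on keeps this evaluation
      far below the 6^8 candidates of the full box.\<close>
    by code_simp
  then show ?thesis
    by (simp add: distinct_card)
qed

text \<open>Over the integers, failure of the bound means \<open>\<bar>x\<bar> \<ge> m + 1\<close>,
  and then \<open>c * x^2\<close> exceeds \<open>n\<close>.\<close>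

lemma abs_le_if_weighted_square_le:
  fixes x c m n :: int
  assumes "c * x^2 \<le> n" "n < c * (m + 1)^2" "0 < c" "0 \<le> m"
  shows "\<bar>x\<bar> \<le> m"
proof (rule ccontr)
  assume "\<not> \<bar>x\<bar> \<le> m"
  then have "(m + 1)^2 \<le> \<bar>x\<bar>^2"
    using assms(4) by (intro power_mono) auto
  then show False
    using mult_left_mono[of "(m + 1)^2" "x^2" c] assms(1-3) unfolding power2_abs by linarith
qed

lemma E82_search_complete:
  fixes x1 x2 x3 x4 x5 x6 x7 x8 :: int
  assumes nonneg: "x1 \<ge> 0" "x2 \<ge> 0" "x3 \<ge> 0" "x4 \<ge> 0" "x5 \<ge> 0" "x6 \<ge> 0" "x7 \<ge> 0" "x8 \<ge> 0"
    and "E82_form x1 x2 x3 x4 x5 x6 x7 x8 \<in> {2, 3}"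
  shows "[x1, x2, x3, x4, x5, x6, x7, x8] \<in> set E82_search"
proof -
  define p3 where "p3 = 6 * x3^2"
  define p2 where "p2 = 4 * (5*x2 - 3*x3)^2"
  define p1 where "p1 = 20 * (3*x1 - x2)^2"
  define p8 where "p8 = 30 * (2*x8 - x3)^2"
  define p4 where "p4 = 3 * (5*x4 - 4*x3)^2"
  define p5 where "p5 = 5 * (4*x5 - 3*x4)^2"
  define p6 where "p6 = 10 * (3*x6 - 2*x5)^2"
  define p7 where "p7 = 30 * (2*x7 - x6)^2"
  note p_defs = p1_def p2_def p3_def p4_def p5_def p6_def p7_def p8_def
  have pos: "p1 \<ge> 0" "p2 \<ge> 0" "p3 \<ge> 0" "p4 \<ge> 0" "p5 \<ge> 0" "p6 \<ge> 0" "p7 \<ge> 0" "p8 \<ge> 0"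
    by (simp_all add: p_defs)
  have total: "p3 + p2 + p1 + p8 + p4 + p5 + p6 + p7 \<in> {120, 180}"
    using assms(9) E82_form_sum_of_squares[of x1 x2 x3 x4 x5 x6 x7 x8]
    by (auto simp: p_defs)
  have le: "p1 \<le> 180" "p2 \<le> 180" "p3 \<le> 180" "p4 \<le> 180" "p5 \<le> 180" "p6 \<le> 180" "p7 \<le> 180" "p8 \<le> 180"
    using pos total by auto
  \<comment> \<open>Each bound is the integer part of the square root of 180/c, where c is the
    weight of the square.\<close>
  have "\<bar>x3\<bar> \<le> 5" "\<bar>5*x2 - 3*x3\<bar> \<le> 6" "\<bar>3*x1 - x2\<bar> \<le> 3" "\<bar>2*x8 - x3\<bar> \<le> 2" "\<bar>5*x4 - 4*x3\<bar> \<le> 7"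
    "\<bar>4*x5 - 3*x4\<bar> \<le> 6" "\<bar>3*x6 - 2*x5\<bar> \<le> 4" "\<bar>2*x7 - x6\<bar> \<le> 2"
    using le unfolding p_defs
    by - (rule abs_le_if_weighted_square_le, assumption, simp, simp, simp)+
  \<comment> \<open>The bound on \<open>x3\<close> propagates along the branches, giving 5 as a
    common bound.\<close>
  then have box: "x1 \<le> 5" "x2 \<le> 5" "x3 \<le> 5" "x4 \<le> 5" "x5 \<le> 5" "x6 \<le> 5" "x7 \<le> 5" "x8 \<le> 5"
    by linarith+
  \<comment> \<open>Dropping nonnegative squares from the total leaves at most 180, so no pruning
    test discards the solution.\<close>
  have partial: "p3 + p2 \<le> 180" "p3 + p2 + p1 \<le> 180" "p3 + p2 + p1 + p8 \<le> 180"
    "p3 + p2 + p1 + p8 + p4 \<le> 180" "p3 + p2 + p1 + p8 + p4 + p5 \<le> 180"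
    "p3 + p2 + p1 + p8 + p4 + p5 + p6 \<le> 180"
    "p3 + p2 + p1 + p8 + p4 + p5 + p6 + p7 = 120 \<or> p3 + p2 + p1 + p8 + p4 + p5 + p6 + p7 = 180"
    using pos total by auto
  show ?thesis
    using nonneg box partial unfolding E82_search_def p_defs by simp
qed

text \<open>The last filter fixes the full sum of squares, hence the value of the form.\<close>

lemma E82_search_sound:
  assumes "xs \<in> set E82_search"
  obtains x1 x2 x3 x4 x5 x6 x7 x8 where "xs = [x1, x2, x3, x4, x5, x6, x7, x8]"
    "x1 \<ge> 0" "x2 \<ge> 0" "x3 \<ge> 0" "x4 \<ge> 0" "x5 \<ge> 0" "x6 \<ge> 0" "x7 \<ge> 0" "x8 \<ge> 0"
    "E82_form x1 x2 x3 x4 x5 x6 x7 x8 \<in> {2, 3}"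
proof -
  obtain x1 x2 x3 x4 x5 x6 x7 x8 where xs: "xs = [x1, x2, x3, x4, x5, x6, x7, x8]"
    and nonneg: "x1 \<ge> 0" "x2 \<ge> 0" "x3 \<ge> 0" "x4 \<ge> 0" "x5 \<ge> 0" "x6 \<ge> 0" "x7 \<ge> 0" "x8 \<ge> 0"
    and "60 * E82_form x1 x2 x3 x4 x5 x6 x7 x8 \<in> {120, 180}"
    using assms unfolding E82_search_def E82_form_sum_of_squares
    by (auto split: if_splits)
  then show ?thesis
    by (intro that[OF xs nonneg]) auto
qed

lemma verts_E82: "verts E82 = {1, 2, 3, 4, 5, 6, 7, 8}"
  by (auto simp: E82_def)

definition E82_coeffs :: "(nat \<Rightarrow>\<^sub>0 int) \<Rightarrow> int list" where
  "E82_coeffs Y = map (Poly_Mapping.lookup Y) [1, 2, 3, 4, 5, 6, 7, 8]"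

lemma intersection_E82:
  "intersection E82 Y Y =
     - E82_form (Poly_Mapping.lookup Y 1) (Poly_Mapping.lookup Y 2) (Poly_Mapping.lookup Y 3)
         (Poly_Mapping.lookup Y 4) (Poly_Mapping.lookup Y 5) (Poly_Mapping.lookup Y 6)
         (Poly_Mapping.lookup Y 7) (Poly_Mapping.lookup Y 8)"
  unfolding intersection_def verts_E82
  by (simp add: vertex_intersection_def E82_def doubleton_eq_iff E82_form_def
      power2_eq_square algebra_simps)

lemma inj_on_E82_coeffs: "inj_on E82_coeffs (divisors E82)"
proof (rule inj_onI)
  fix Y Z assume "Y \<in> divisors E82" "Z \<in> divisors E82" and eq: "E82_coeffs Y = E82_coeffs Z"
  then have "Poly_Mapping.lookup Y v = 0 \<and> Poly_Mapping.lookup Z v = 0" if "v \<notin> verts E82" for v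
    using that by (auto simp: divisors_def in_keys_iff)
  moreover have "Poly_Mapping.lookup Y v = Poly_Mapping.lookup Z v" if "v \<in> verts E82" for v
    using that eq by (auto simp: verts_E82 E82_coeffs_def)
  ultimately show "Y = Z"
    by (intro poly_mapping_eqI) metis
qed

lemma E82_coeffs_surj:
  assumes "length xs = 8"
  shows "\<exists>Y \<in> divisors E82. E82_coeffs Y = xs"
proof
  \<comment> \<open>Vertices are numbered from 1 but list positions from 0, so a leading 0 shifts
    \<open>xs\<close> into place; beyond the list the default coefficient is 0.\<close>
  let ?Y = "Poly_Mapping.nth (0 # xs)"
  show "E82_coeffs ?Y = xs"
    using assms by (auto simp: E82_coeffs_def nth.rep_eq nth_default_def length_Suc_conv numeral_eq_Suc)
  show "?Y \<in> divisors E82"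
  proof -
    have "v \<in> verts E82" if "Poly_Mapping.lookup ?Y v \<noteq> 0" for v
      using that assms by (cases v) (auto simp: nth.rep_eq nth_default_def E82_def split: if_splits)
    then show ?thesis
      unfolding divisors_def by (blast dest: in_keys_iff[THEN iffD1])
  qed
qed

lemma positive_roots_E82:
  "E82_coeffs ` {Y \<in> positive_divisors E82. intersection E82 Y Y \<in> {-2, -3}} = set E82_search"
proof (intro equalityI subsetI)
  fix xs assume "xs \<in> E82_coeffs ` {Y \<in> positive_divisors E82. intersection E82 Y Y \<in> {-2, -3}}"
  then show "xs \<in> set E82_search"
    by (auto simp: E82_coeffs_def intersection_E82 positive_divisors_def verts_E82
        intro!: E82_search_complete)
next
  fix xs assume "xs \<in> set E82_search"
  then obtain x1 x2 x3 x4 x5 x6 x7 x8 where xs: "xs = [x1, x2, x3, x4, x5, x6, x7, x8]"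
    and nonneg: "x1 \<ge> 0" "x2 \<ge> 0" "x3 \<ge> 0" "x4 \<ge> 0" "x5 \<ge> 0" "x6 \<ge> 0" "x7 \<ge> 0" "x8 \<ge> 0"
    and form: "E82_form x1 x2 x3 x4 x5 x6 x7 x8 \<in> {2, 3}"
    by (rule E82_search_sound)
  obtain Y where Y: "Y \<in> divisors E82" "E82_coeffs Y = xs"
    using E82_coeffs_surj[of xs] xs by auto
  have "intersection E82 Y Y \<in> {-2, -3}"
    using Y(2) form by (auto simp: xs E82_coeffs_def intersection_E82)
  moreover from this have "Y \<noteq> 0"
    by (auto simp: intersection_def)
  moreover have "Poly_Mapping.lookup Y v \<ge> 0" if "v \<in> verts E82" for v
    using that Y(2) nonneg by (auto simp: xs E82_coeffs_def verts_E82)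
  ultimately have "Y \<in> {Y \<in> positive_divisors E82. intersection E82 Y Y \<in> {-2, -3}}"
    using Y(1) by (auto simp: positive_divisors_def)
  with Y(2) show "xs \<in> E82_coeffs ` {Y \<in> positive_divisors E82. intersection E82 Y Y \<in> {-2, -3}}"
    by blast
qed

lemma uminus_divisors_iff: "- Y \<in> divisors \<Gamma> \<longleftrightarrow> Y \<in> divisors \<Gamma>"
  by (simp add: divisors_def in_keys_iff subset_iff)

lemma uminus_positive_divisors_iff: "- Y \<in> positive_divisors \<Gamma> \<longleftrightarrow> Y \<in> negative_divisors \<Gamma>"
  by (simp add: positive_divisors_def negative_divisors_def uminus_divisors_iff)

lemma intersection_uminus: "intersection \<Gamma> (- Y) (- Z) = intersection \<Gamma> Y Z"
  by (simp add: intersection_def)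

lemma positive_negative_divisors_disjoint: "positive_divisors \<Gamma> \<inter> negative_divisors \<Gamma> = {}"
proof -
  have False if Y: "Y \<in> positive_divisors \<Gamma>" "Y \<in> negative_divisors \<Gamma>" for Y
  proof -
    have "Poly_Mapping.lookup Y v = 0" for v
      using Y by (cases "v \<in> verts \<Gamma>")
        (force simp: positive_divisors_def negative_divisors_def divisors_def in_keys_iff)+
    then have "Y = 0"
      by (intro poly_mapping_eqI) simp
    with Y show False
      by (simp add: positive_divisors_def)
  qed
  then show ?thesis by blast
qed

text \<open>Negation preserves self-intersection and exchanges positive with negative divisors, and
  no divisor is both, since such a divisor would be zero.\<close>

lemma card_triple_root_system:
  fixes \<Gamma> :: "'a weighted_graph"
  defines "P \<equiv> {Y \<in> positive_divisors \<Gamma>. intersection \<Gamma> Y Y \<in> {-2, -3}}"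
  assumes "finite P"
  shows "card (triple_root_system \<Gamma>) = 2 * card P"
proof -
  have "triple_root_system \<Gamma> = P \<union> uminus ` P"
  proof (intro equalityI subsetI)
    fix Y assume "Y \<in> triple_root_system \<Gamma>"
    then have "Y \<in> P \<or> - Y \<in> P"
      by (auto simp: triple_root_system_def P_def uminus_positive_divisors_iff intersection_uminus)
    then show "Y \<in> P \<union> uminus ` P"
      by (metis UnI1 UnI2 image_eqI minus_minus)
  next
    fix Y assume "Y \<in> P \<union> uminus ` P"
    then show "Y \<in> triple_root_system \<Gamma>"
      \<comment> \<open>At \<open>- Y\<close> the double negation cancels, so the equivalence reads:
        \<open>Y\<close> is positive iff \<open>- Y\<close> is negative.\<close>
      using uminus_positive_divisors_iff[of "- Y" for Y :: "'a \<Rightarrow>\<^sub>0 int"]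
      by (auto simp: triple_root_system_def P_def intersection_uminus)
  qed
  moreover have "P \<inter> uminus ` P = {}"
    using positive_negative_divisors_disjoint[of \<Gamma>]
    by (auto simp: P_def uminus_positive_divisors_iff)
  moreover have "card (uminus ` P) = card P"
    by (simp add: card_image)
  ultimately show ?thesis
    using \<open>finite P\<close> by (simp add: card_Un_disjoint)
qed

theorem proposition3p28:
  shows "card (triple_root_system E82) = 212"
proof -
  let ?P = "{Y \<in> positive_divisors E82. intersection E82 Y Y \<in> {-2, -3}}"
  have inj: "inj_on E82_coeffs ?P"
    using inj_on_E82_coeffs by (rule inj_on_subset) (auto simp: positive_divisors_def)
  have "finite ?P"
    using inj by (rule inj_on_finite[where B = "set E82_search"]) (simp_all only: positive_roots_E82 order_refl List.finite_set)
  moreover have "card ?P = 106"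
    using card_image[OF inj] unfolding positive_roots_E82 card_E82_search by (rule sym)
  ultimately show ?thesis
    using card_triple_root_system[of E82] by linarith
qed

end
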